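(* Let $N\ge1$ and let $z_1^{(1)},\dots,z_1^{(N)}$ and $z_2^{(1)},\dots,z_2^{(N)}$ in $\mathbb{R}^d$ be the embeddings of the two augmented views of a batch of $N$ inputs, and assume that the contrastive loss $\mathcal{L}_{\text{NT-Xent}}$ of these embeddings is minimized. Let $P=\frac1N\sum_{i=1}^N\delta_{z_1^{(i)}}$, $Q=\frac1N\sum_{i=1}^N\delta_{z_2^{(i)}}$ and $C_{ij}=\|z_1^{(i)}-z_2^{(j)}\|^2$. Let $\lambda>0$ and let $\gamma^*$ be the optimal transport plan of the entropy-regularized problem $$\min_{\gamma\in\Pi(P,Q)}\;\langle\gamma,C\rangle-\lambda H(\gamma).$$ Then $\gamma^*_{ij}>0$ for all $i,j\in\{1,\dots,N\}$.
   Context: $\Pi(P,Q)$ is the set of couplings of $P$ and $Q$, identified with the $N\times N$ matrices $\gamma$ with nonnegative entries whose row sums and column sums all equal $1/N$. $\langle\gamma,C\rangle=\sum_{i,j}\gamma_{ij}C_{ij}$. The entropy is $H(\gamma)=-\sum_{i,j}\gamma_{ij}\log\gamma_{ij}$, with the convention $0\log0=0$. $\|\cdot\|$ is the Euclidean norm. Contrastive loss: the embeddings are produced from inputs $x$ as $z=g_\phi(f_\theta(x))$, where $f_\theta$ is an encoder network and $g_\phi$ a projection head with trainable parameters $\theta,\phi$. List the $2N$ embeddings of the batch (both views) as $z_1,\dots,z_{2N}$. For a positive pair, i.e. indices $i\ne j$ of the two views of the same input, the NT-Xent loss is $$-\log\frac{\exp(\mathrm{sim}(z_i,z_j)/\tau)}{\sum_{k=1}^{2N}\mathbf{1}_{[k\ne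 i]}\exp(\mathrm{sim}(z_i,z_k)/\tau)},$$ where $\mathrm{sim}$ is cosine similarity and $\tau>0$ is a temperature; $\mathcal{L}_{\text{NT-Xent}}$ is the average of this quantity over all positive pairs of the batch. "Minimized" means minimized over the parameters $\theta,\phi$. *)

theory Defs
  imports "HOL-Analysis.Analysis"
begin

(* For a zero vector the quotient is 0, by the convention x / 0 = 0. *)
definition cosine_sim :: "'a::real_inner \<Rightarrow> 'a \<Rightarrow> real" where
  "cosine_sim u v = (u \<bullet> v) / (norm u * norm v)"

(* A batch of N = CARD('n) inputs has 2N embeddings; they are indexed by 'n + 'n, where Inl i and
   Inr i are the first and the second view of the input i. *)
definition positive_pairs :: "(('n::finite + 'n) \<times> ('n + 'n)) set" where
  "positive_pairs = {(a, b). a \<noteq> b \<and> case_sum id id a = case_sum id id b}"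

definition nt_xent_pair ::
    "real \<Rightarrow> ('b::finite \<Rightarrow> 'a::real_inner) \<Rightarrow> 'b \<Rightarrow> 'b \<Rightarrow> real" where
  "nt_xent_pair \<tau> z a b =
     - ln (exp (cosine_sim (z a) (z b) / \<tau>) /
           (\<Sum>k\<in>UNIV - {a}. exp (cosine_sim (z a) (z k) / \<tau>)))"

(* The pair loss is not symmetric, so the average is over ordered positive pairs. *)
definition nt_xent ::
    "real \<Rightarrow> ('n::finite \<Rightarrow> 'a::real_inner) \<Rightarrow> ('n \<Rightarrow> 'a) \<Rightarrow> real" where
  "nt_xent \<tau> z1 z2 =
     (\<Sum>(a, b)\<in>positive_pairs. nt_xent_pair \<tau> (case_sum z1 z2) a b) /
     real (card (positive_pairs :: (('n + 'n) \<times> ('n + 'n)) set))"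

(* Couplings of two uniform empirical measures on CARD('n) indexed atoms, as matrices of masses. *)
definition couplings :: "(real ^ 'n ^ 'n) set" where
  "couplings = {\<gamma>. (\<forall>i j. 0 \<le> \<gamma> $ i $ j) \<and>
                    (\<forall>i. (\<Sum>j\<in>UNIV. \<gamma> $ i $ j) = 1 / real CARD('n)) \<and>
                    (\<forall>j. (\<Sum>i\<in>UNIV. \<gamma> $ i $ j) = 1 / real CARD('n))}"

definition cost_matrix ::
    "('n \<Rightarrow> 'a::real_normed_vector) \<Rightarrow> ('n \<Rightarrow> 'a) \<Rightarrow> real ^ 'n ^ 'n" where
  "cost_matrix z1 z2 = (\<chi> i j. (norm (z1 i - z2 j))\<^sup>2)"

definition entropy :: "real ^ 'n ^ 'n \<Rightarrow> real" where
  "entropy \<gamma> = - (\<Sum>i\<in>UNIV. \<Sum>j\<in>UNIV. \<gamma> $ i $ j * ln (\<gamma> $ i $ j))"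

definition entropic_ot_objective :: "real \<Rightarrow> real ^ 'n ^ 'n \<Rightarrow> real ^ 'n ^ 'n \<Rightarrow> real" where
  "entropic_ot_objective lam C \<gamma> = \<gamma> \<bullet> C - lam * entropy \<gamma>"

end

theory Submission imports Defs
begin

text \<open>
  A minimizer with a vanishing entry is mixed with the uniform coupling: on the mixture with weight
  \<open>t\<close> the objective exceeds its convex interpolation by at most a positive multiple of \<open>t * ln t\<close>,
  and dividing by \<open>t\<close> and letting \<open>t\<close> tend to 0 contradicts minimality.
\<close>

text \<open>The left side is the tangent line at \<open>w\<close> of the convex function x * ln x,
  whose slope there is ln w + 1. For positive \<open>x\<close> the inequality is ln y \<le> y - 1 at
  y = w / x; at \<open>x = 0\<close> it reads - w \<le> 0.\<close>

lemma xlnx_tangent_le: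
  fixes x w :: real
  assumes "0 \<le> x" "0 < w"
  shows "x * ln w + x - w \<le> x * ln x"
proof (cases "x = 0")
  case False
  then have x: "0 < x" using assms by simp
  have "ln (w / x) \<le> w / x - 1"
    using x assms by (intro ln_le_minus_one) simp
  then have "x * (ln w - ln x) \<le> x * (w / x - 1)"
    using x assms by (intro mult_left_mono) (simp_all add: ln_div)
  then show ?thesis using x by (simp add: algebra_simps)
qed (use assms in simp)

text \<open>Convexity with the endpoint \<open>x = 0\<close> included: the tangent at the mean
  \<open>w\<close> bounds the function from below at both \<open>x\<close> and \<open>u\<close>, and
  in the weighted sum the linear terms cancel.\<close>

lemma xlnx_mix_le:
  fixes x u t :: real
  assumes "0 \<le> x" "0 < u" "0 < t" "t \<le> 1"
  defines "w \<equiv> (1 - t) * x + t * u"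
  shows "w * ln w \<le> (1 - t) * (x * ln x) + t * (u * ln u)"
proof -
  have w: "0 < w"
    unfolding w_def using assms by (intro add_nonneg_pos) auto
  have "(1 - t) * (x * ln w + x - w) + t * (u * ln w + u - w)
      \<le> (1 - t) * (x * ln x) + t * (u * ln u)"
    using assms w by (intro add_mono mult_left_mono xlnx_tangent_le) auto
  moreover have "(1 - t) * (x * ln w + x - w) + t * (u * ln w + u - w) = w * ln w"
    by (simp add: w_def algebra_simps)
  ultimately show ?thesis by simp
qed

text \<open>Concavity of the entropy, sharpened at one entry: where \<gamma> vanishes, the mixture
  is t * m with m the entry of \<mu>, and t * m * ln (t * m) splits exactly into t * (m * ln m) and
  t * m * ln t. The second part is the gain.\<close>

lemma entropy_mix_ge:
  fixes \<gamma> \<mu> :: "real ^ 'n::finite ^ 'n"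
  assumes \<gamma>: "\<And>i j. 0 \<le> \<gamma> $ i $ j" and \<mu>: "\<And>i j. 0 < \<mu> $ i $ j"
    and t: "0 < t" "t \<le> 1" and zero: "\<gamma> $ a $ b = 0"
  shows "(1 - t) * entropy \<gamma> + t * entropy \<mu> - t * \<mu> $ a $ b * ln t
    \<le> entropy ((1 - t) *\<^sub>R \<gamma> + t *\<^sub>R \<mu>)"
proof -
  let ?h = "\<lambda>x::real. x * ln x"
  let ?w = "\<lambda>i j. (1 - t) * \<gamma> $ i $ j + t * \<mu> $ i $ j"
  \<comment> \<open>The conditionals are nested so that the double sum collapses one index at a
    time.\<close>
  let ?c = "\<lambda>i j. if i = a then if j = b then t * \<mu> $ a $ b * ln t else 0 else 0"
  have "(\<Sum>i\<in>UNIV. \<Sum>j\<in>UNIV. ?h (?w i j))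
      \<le> (\<Sum>i\<in>UNIV. \<Sum>j\<in>UNIV. (1 - t) * ?h (\<gamma> $ i $ j) + t * ?h (\<mu> $ i $ j) + ?c i j)"
  proof (intro sum_mono)
    fix i j
    show "?h (?w i j) \<le> (1 - t) * ?h (\<gamma> $ i $ j) + t * ?h (\<mu> $ i $ j) + ?c i j"
    proof (cases "i = a \<and> j = b")
      case True
      then show ?thesis
        using \<mu>[of a b] t zero by (simp add: ln_mult algebra_simps)
    next
      case False
      then have "?c i j = 0" by auto
      then show ?thesis
        using xlnx_mix_le[OF \<gamma> \<mu> t, of i j i j] by simp
    qed
  qed
  also have "\<dots> = (1 - t) * (\<Sum>i\<in>UNIV. \<Sum>j\<in>UNIV. ?h (\<gamma> $ i $ j))
      + t * (\<Sum>i\<in>UNIV. \<Sum>j\<in>UNIV. ?h (\<mu> $ i $ j)) + t * \<mu> $ a $ b * ln t"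
  proof -
    have "(\<Sum>i\<in>UNIV. \<Sum>j\<in>UNIV. ?c i j) = (\<Sum>i\<in>UNIV. if i = a then t * \<mu> $ a $ b * ln t else 0)"
      by (intro sum.cong) auto
    then show ?thesis
      by (simp add: sum.distrib sum_distrib_left)
  qed
  finally show ?thesis
    by (simp add: entropy_def)
qed

text \<open>Supplies a coupling with all entries positive, as \<open>entropy_mix_ge\<close> requires
  of its second matrix.\<close>

lemma uniform_coupling:
  "(\<chi> i j. 1 / (real CARD('n))\<^sup>2 :: real ^ 'n::finite ^ 'n) \<in> couplings"
  by (simp add: couplings_def power2_eq_square)

lemma mix_coupling:
  fixes \<gamma> \<mu> :: "real ^ 'n::finite ^ 'n"
  assumes "\<gamma> \<in> couplings" "\<mu> \<in> couplings" "0 \<le> t" "t \<le> 1"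
  shows "(1 - t) *\<^sub>R \<gamma> + t *\<^sub>R \<mu> \<in> couplings"
  using assms
  by (simp add: couplings_def sum.distrib flip: sum_distrib_left distrib_right)
     (simp add: field_simps)

lemma entropic_ot_minimizer_pos:
  fixes C \<gamma> :: "real ^ 'n::finite ^ 'n"
  assumes lam: "0 < lam"
    and min: "is_arg_min (entropic_ot_objective lam C) (\<lambda>\<gamma>'. \<gamma>' \<in> couplings) \<gamma>"
  shows "0 < \<gamma> $ a $ b"
proof (rule ccontr)
  let ?F = "entropic_ot_objective lam C"
  define \<mu> :: "real ^ 'n ^ 'n" where "\<mu> = (\<chi> i j. 1 / (real CARD('n))\<^sup>2)"
  have \<gamma>: "\<gamma> \<in> couplings" and le: "\<And>\<gamma>'. \<gamma>' \<in> couplings \<Longrightarrow> ?F \<gamma> \<le> ?F \<gamma>'"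
    using min by (auto simp: is_arg_min_linorder)
  have \<gamma>0: "0 \<le> \<gamma> $ i $ j" for i j
    using \<gamma> by (simp add: couplings_def)
  have \<mu>: "\<mu> \<in> couplings" and \<mu>0: "0 < \<mu> $ i $ j" for i j
    using uniform_coupling by (auto simp: \<mu>_def)
  assume "\<not> 0 < \<gamma> $ a $ b"
  then have zero: "\<gamma> $ a $ b = 0" using \<gamma>0[of a b] by simp
  \<comment> \<open>An explicit \<open>t\<close> replaces the limit: \<open>K\<close> solves lam *
    \<mu>$a$b * K = \<bar>F \<mu> - F \<gamma>\<bar> + 1, so at \<open>t = exp (- K)\<close> the
    logarithmic gain outweighs any excess of F \<mu> over F \<gamma>. The summand 1 makes this
    strict and keeps \<open>K\<close> positive, hence t < 1.\<close>
  define K where "K = (\<bar>?F \<mu> - ?F \<gamma>\<bar> + 1) / (lam * \<mu> $ a $ b)"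
  define t where "t = exp (- K)"
  have K: "0 < K"
    using lam \<mu>0[of a b] by (simp add: K_def)
  have t: "0 < t" "t \<le> 1" and lnt: "ln t = - K"
    using K by (auto simp: t_def)
  have "?F \<gamma> \<le> ?F ((1 - t) *\<^sub>R \<gamma> + t *\<^sub>R \<mu>)"
    using \<gamma> \<mu> t by (intro le mix_coupling) auto
  \<comment> \<open>The transport cost is linear and interpolates exactly; only the entropy term
    contributes the extra summand.\<close>
  also have "\<dots> \<le> (1 - t) * ?F \<gamma> + t * ?F \<mu> + t * (lam * \<mu> $ a $ b * ln t)"
    using mult_left_mono[OF entropy_mix_ge[OF \<gamma>0 \<mu>0 t zero], of lam] lam
    by (simp add: entropic_ot_objective_def inner_add_left algebra_simps)
  finally have "t * ?F \<gamma> \<le> t * (?F \<mu> + lam * \<mu> $ a $ b * ln t)"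
    by (simp add: algebra_simps)
  then have "?F \<gamma> \<le> ?F \<mu> + lam * \<mu> $ a $ b * ln t"
    using t by simp
  moreover have "lam * \<mu> $ a $ b * ln t = - (\<bar>?F \<mu> - ?F \<gamma>\<bar> + 1)"
    using lam \<mu>0[of a b] by (simp add: lnt K_def)
  ultimately show False by linarith
qed

theorem lemma2:
  fixes f :: "'p \<Rightarrow> 'x \<Rightarrow> 'h" and g :: "'q \<Rightarrow> 'h \<Rightarrow> real ^ 'd"
    and \<Theta> :: "'p set" and \<Phi> :: "'q set" and \<theta> :: 'p and \<phi> :: 'q
    and x1 x2 :: "'n::finite \<Rightarrow> 'x"
    and z1 z2 :: "'n \<Rightarrow> real ^ 'd"
    and \<tau> lam :: real
    and \<gamma> :: "real ^ 'n ^ 'n"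
  assumes "\<tau> > 0"
    and "\<And>i. z1 i = g \<phi> (f \<theta> (x1 i))"
    and "\<And>i. z2 i = g \<phi> (f \<theta> (x2 i))"
    and "is_arg_min
           (\<lambda>(\<theta>', \<phi>'). nt_xent \<tau> (\<lambda>i. g \<phi>' (f \<theta>' (x1 i))) (\<lambda>i. g \<phi>' (f \<theta>' (x2 i))))
           (\<lambda>(\<theta>', \<phi>'). \<theta>' \<in> \<Theta> \<and> \<phi>' \<in> \<Phi>) (\<theta>, \<phi>)"
    and "lam > 0"
    and "is_arg_min (entropic_ot_objective lam (cost_matrix z1 z2)) (\<lambda>\<gamma>'. \<gamma>' \<in> couplings) \<gamma>"
  shows "\<forall>i j. \<gamma> $ i $ j > 0"
  using entropic_ot_minimizer_pos[OF assms(5,6)] by blast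

end
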